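(* Let $S$ be a set of positive integers and $P$ a set of primes such that every element of $S$ is less than every element of $P$. Then $$\mathcal M_{S\cup P}(q) = \frac{\mathcal M_S(q)}{\prod_{j\in P}(1-q^j)}.$$
   Context: For a set $T$ of positive integers, $M_T(n)$ is the number of distinct values of the multinomial coefficients $n!/(\lambda_1!\cdots\lambda_r!)$ as $(\lambda_1,\dots,\lambda_r)$ ranges over the partitions of $n$ with all parts in $T$, and $\mathcal M_T(q) := \sum_{n\ge0} M_T(n) q^n$ as a formal power series. *)

theory Defs
  imports
    "HOL-Computational_Algebra.Formal_Power_Series"
    "HOL-Computational_Algebra.Primes"
    "HOL-Analysis.Infinite_Products"
begin

definition partitions_into :: "nat set \<Rightarrow> nat \<Rightarrow> nat multiset set" where
  "partitions_into T n = {l. 0 \<notin># l \<and> set_mset l \<subseteq> T \<and> sum_mset l = n}"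

definition multinomial_coeff :: "nat multiset \<Rightarrow> rat" where
  "multinomial_coeff l = fact (sum_mset l) / (\<Prod>i\<in>#l. fact i)"

definition multinomial_count :: "nat set \<Rightarrow> nat \<Rightarrow> nat" where
  "multinomial_count T n = card (multinomial_coeff ` partitions_into T n)"

definition multinomial_gf :: "nat set \<Rightarrow> rat fps" where
  "multinomial_gf T = Abs_fps (\<lambda>n. of_nat (multinomial_count T n))"

text \<open>
  The index set may be infinite, in which case \<^const>\<open>prod\<close> would return \<open>1\<close>. The product is
  therefore taken as the limit of its partial products in the \<open>X\<close>-adic metric on
  formal power series; \<open>euler_prod_convergent\<close> shows that this limit exists.
\<close>
definition euler_prod :: "nat set \<Rightarrow> rat fps" where
  "euler_prod A = (\<Prod>j. if j \<in> A then 1 - fps_X ^ j else 1)"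

lemma euler_prod_convergent:
  assumes "0 \<notin> A"
  shows "(\<lambda>j. if j \<in> A then 1 - fps_X ^ j else 1) has_prod euler_prod A"
proof -
  define f :: "nat \<Rightarrow> rat fps" where "f = (\<lambda>j. if j \<in> A then 1 - fps_X ^ j else 1)"
  define L where "L = Abs_fps (\<lambda>n. fps_nth (\<Prod>j\<le>n. f j) n)"
  have stable: "fps_nth (\<Prod>j\<le>N. f j) n = fps_nth (\<Prod>j\<le>n. f j) n" if "n \<le> N" for n N
    using that
  proof (induction N rule: dec_induct)
    case (step m)
    have "fps_nth (g * f (Suc m)) n = fps_nth g n" for g
    proof (cases "Suc m \<in> A")
      case True
      then have "g * f (Suc m) = g - g * fps_X ^ Suc m"
        unfolding f_def by (simp only: if_True right_diff_distrib mult_1_right)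
      moreover have "fps_nth (g * fps_X ^ Suc m) n = 0"
        using step.hyps by (simp only: fps_X_power_mult_right_nth) simp
      ultimately show ?thesis
        by (simp only: fps_sub_nth diff_zero)
    qed (simp add: f_def)
    then show ?case
      using step.IH by (simp only: prod.atMost_Suc)
  qed simp
  have "(\<lambda>N. \<Prod>j\<le>N. f j) \<longlonglongrightarrow> L"
  proof (rule tendsto_fpsI)
    fix n
    show "\<forall>\<^sub>F N in sequentially. fps_nth (\<Prod>j\<le>N. f j) n = fps_nth L n"
      using eventually_ge_at_top[of n] by eventually_elim (simp only: L_def fps_nth_Abs_fps, rule stable)
  qed
  moreover have "fps_nth L 0 = 1"
    using assms by (simp add: L_def f_def)
  then have "L \<noteq> 0"
    by auto
  ultimately have "f has_prod L"
    by (simp add: has_prod_def raw_has_prod_def)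
  then show ?thesis
    using has_prod_unique[of f L] by (simp add: euler_prod_def f_def)
qed

end

theory Submission
  imports Defs
begin

text \<open>
  For fixed \<open>n\<close> the coefficient of a partition \<open>l\<close> is determined by \<open>D(l) = \<Prod>i\<in>#l. i!\<close>. If \<open>p\<close> is a
  prime exceeding all elements of \<open>T\<close>, then for a partition \<open>l\<close> into parts from \<open>T \<union> {p}\<close> the prime
  \<open>p\<close> divides \<open>D(l)\<close> iff \<open>p\<close> is a part of \<open>l\<close>. So the values from partitions with and without a part
  \<open>p\<close> are disjoint, and removing one part \<open>p\<close> divides \<open>D(l)\<close> by \<open>p!\<close>; hence
  \<open>M(T \<union> {p}, n) = M(T, n) + M(T \<union> {p}, n - p)\<close>, the last term being \<open>0\<close> for \<open>n < p\<close>. Adjoining the elements of \<open>P\<close> in increasing order and passing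
  to the \<open>X\<close>-adic limit gives the theorem.
\<close>

text \<open>Valued in \<open>nat\<close> rather than \<open>rat\<close>, so that divisibility by a
  prime is meaningful.\<close>

definition fact_prod :: "nat multiset \<Rightarrow> nat" where
  "fact_prod l = (\<Prod>i\<in>#l. fact i)"

lemma fact_prod_add_mset [simp]: "fact_prod (add_mset x l) = fact x * fact_prod l"
  by (simp add: fact_prod_def)

lemma fact_prod_pos: "fact_prod l > 0"
  by (induction l) (simp_all add: fact_prod_def)

lemma multinomial_coeff_eq: "multinomial_coeff l = fact (sum_mset l) / of_nat (fact_prod l)"
proof -
  have "(\<Prod>i\<in>#l. fact i :: rat) = of_nat (fact_prod l)"
    by (induction l) (simp_all add: fact_prod_def)
  then show ?thesis
    by (simp add: multinomial_coeff_def)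
qed

text \<open>Dividing the nonzero constant n! by positive integers is injective, so distinct
  denominators give distinct coefficients.\<close>

lemma multinomial_count_eq_card_fact_prod:
  "multinomial_count T n = card (fact_prod ` partitions_into T n)"
proof -
  define g :: "nat \<Rightarrow> rat" where "g d = fact n / of_nat d" for d
  have "multinomial_coeff ` partitions_into T n = g ` fact_prod ` partitions_into T n"
    unfolding image_image
    by (rule image_cong) (auto simp: g_def multinomial_coeff_eq partitions_into_def)
  moreover have "inj_on g (fact_prod ` partitions_into T n)"
    using fact_prod_pos by (auto simp: inj_on_def g_def field_simps)
  ultimately show ?thesis
    by (simp add: multinomial_count_def card_image)
qed

lemma size_le_sum_mset:
  fixes l :: "nat multiset"
  assumes "0 \<notin># l"
  shows "size l \<le> sum_mset l"
  using assms by (induction l) auto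

lemma set_mset_subset_atMost_sum_mset: "set_mset l \<subseteq> {..sum_mset l}" for l :: "nat multiset"
  by (auto dest: multi_member_split)

text \<open>A partition of n has at most n parts, each at most n.\<close>

lemma finite_partitions_into: "finite (partitions_into T n)"
proof (rule finite_subset)
  show "partitions_into T n \<subseteq> (\<Union>k\<le>n. multisets_of_size {..n} k)"
    using size_le_sum_mset set_mset_subset_atMost_sum_mset
    unfolding partitions_into_def multisets_of_size_def by blast
  show "finite (\<Union>k\<le>n. multisets_of_size {..n} k)"
    by (intro finite_UN_I finite_multisets_of_size) auto
qed

lemma partitions_into_cong:
  assumes "T \<inter> {..n} = U \<inter> {..n}"
  shows "partitions_into T n = partitions_into U n"
  using assms set_mset_subset_atMost_sum_mset unfolding partitions_into_def by blast

text \<open>Split by whether p occurs as a part. The guard p \<le> n matters: for n < p truncated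
  subtraction gives n - p = 0, and the empty partition would be counted.\<close>

lemma partitions_into_insert:
  assumes "0 < p"
  shows "partitions_into (insert p T) n = partitions_into T n \<union>
    (if p \<le> n then add_mset p ` partitions_into (insert p T) (n - p) else {})" (is "?L = ?R")
proof
  show "?L \<subseteq> ?R"
  proof
    fix l assume l: "l \<in> ?L"
    show "l \<in> ?R"
    proof (cases "p \<in># l")
      case True
      then obtain m where "l = add_mset p m"
        by (blast dest: multi_member_split)
      with l show ?thesis
        by (auto simp: partitions_into_def)
    next
      case False
      with l show ?thesis
        by (auto simp: partitions_into_def)
    qed
  qed
  show "?R \<subseteq> ?L"
    using assms by (auto simp: partitions_into_def split: if_splits)
qed

text \<open>By Euclid's lemma p divides some factor i!, and p divides i! exactly when p \<le>
  i.\<close>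

lemma prime_dvd_fact_prod_iff:
  assumes "prime p"
  shows "p dvd fact_prod l \<longleftrightarrow> (\<exists>i\<in>#l. p \<le> i)"
  using assms
  by (induction l) (auto simp: fact_prod_def prime_dvd_mult_iff prime_dvd_fact_iff)

lemma multinomial_count_insert_prime:
  assumes "prime p" and "\<forall>t\<in>T. t < p"
  shows "multinomial_count (insert p T) n =
    multinomial_count T n + (if p \<le> n then multinomial_count (insert p T) (n - p) else 0)"
proof (cases "p \<le> n")
  case False
  then show ?thesis
    using assms
    by (simp add: multinomial_count_eq_card_fact_prod partitions_into_insert[of p T n] prime_gt_0_nat)
next
  case True
  define A where "A = fact_prod ` partitions_into T n"
  define B where "B = fact_prod ` partitions_into (insert p T) (n - p)"
  have eq: "fact_prod ` partitions_into (insert p T) n = A \<union> (*) (fact p) ` B"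
    using assms True
    by (simp add: partitions_into_insert[of p T n] prime_gt_0_nat image_Un image_image A_def B_def)
  have "\<not> p dvd a" if "a \<in> A" for a
  proof -
    from that obtain l where "a = fact_prod l" "set_mset l \<subseteq> T"
      by (auto simp: A_def partitions_into_def)
    then show ?thesis
      using assms by (auto simp: prime_dvd_fact_prod_iff not_le)
  qed
  moreover have "p dvd b" if "b \<in> (*) (fact p) ` B" for b
    using that assms by (auto simp: prime_dvd_mult_iff prime_dvd_fact_iff)
  ultimately have "A \<inter> (*) (fact p) ` B = {}"
    by blast
  moreover have "finite A" "finite B"
    by (simp_all add: A_def B_def finite_partitions_into)
  \<comment> \<open>Multiplication by the positive number p! is injective.\<close>
  moreover have "card ((*) (fact p) ` B) = card B"
    by (intro card_image) (auto simp: inj_on_def)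
  ultimately show ?thesis
    using True eq
    by (simp add: multinomial_count_eq_card_fact_prod card_Un_disjoint A_def B_def)
qed

text \<open>This is the counting recurrence read coefficientwise: multiplying by
  \<open>fps_X ^ p\<close> shifts indices by p and gives 0 below p.\<close>

lemma multinomial_gf_insert_prime:
  assumes "prime p" and "\<forall>t\<in>T. t < p"
  shows "multinomial_gf (insert p T) * (1 - fps_X ^ p) = multinomial_gf T"
proof (rule fps_ext)
  fix n
  show "fps_nth (multinomial_gf (insert p T) * (1 - fps_X ^ p)) n = fps_nth (multinomial_gf T) n"
    using multinomial_count_insert_prime[OF assms, of n]
    by (simp add: multinomial_gf_def right_diff_distrib fps_X_power_mult_right_nth)
qed

lemma multinomial_gf_Un_primes_atMost:
  assumes "\<forall>p\<in>P. prime p" and "\<forall>s\<in>S. \<forall>p\<in>P. s < p"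
  shows "multinomial_gf (S \<union> (P \<inter> {..N})) * (\<Prod>j\<le>N. if j \<in> P then 1 - fps_X ^ j else 1) =
    multinomial_gf S"
proof (induction N)
  case 0
  have "0 \<notin> P"
    using assms(1) by auto
  then show ?case
    by auto
next
  case (Suc N)
  show ?case
  proof (cases "Suc N \<in> P")
    case True
    then have "S \<union> (P \<inter> {..Suc N}) = insert (Suc N) (S \<union> (P \<inter> {..N}))"
      by (auto simp: le_Suc_eq)
    moreover have "multinomial_gf (insert (Suc N) (S \<union> (P \<inter> {..N}))) * (1 - fps_X ^ Suc N) =
        multinomial_gf (S \<union> (P \<inter> {..N}))"
      \<comment> \<open>\<open>Suc N\<close> exceeds S by hypothesis and the primes adjoined earlier
        because they are at most N.\<close>
      using True assms by (intro multinomial_gf_insert_prime) auto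
    ultimately have "multinomial_gf (S \<union> (P \<inter> {..N})) =
        multinomial_gf (S \<union> (P \<inter> {..Suc N})) * (1 - fps_X ^ Suc N)"
      by simp
    with True Suc.IH show ?thesis
      by (simp add: mult_ac del: power_Suc)
  next
    case False
    then have "P \<inter> {..Suc N} = P \<inter> {..N}"
      by (auto simp: le_Suc_eq)
    with False Suc.IH show ?thesis
      by simp
  qed
qed

text \<open>Partitions of n use no part above n, so the n-th coefficient is constant once N \<ge>
  n.\<close>

lemma multinomial_gf_tendsto: "(\<lambda>N. multinomial_gf (S \<union> (P \<inter> {..N}))) \<longlonglongrightarrow> multinomial_gf (S \<union> P)"
proof (rule tendsto_fpsI)
  fix n
  show "\<forall>\<^sub>F N in sequentially.
      fps_nth (multinomial_gf (S \<union> (P \<inter> {..N}))) n = fps_nth (multinomial_gf (S \<union> P)) n"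
    using eventually_ge_at_top[of n]
  proof eventually_elim
    case (elim N)
    then have "partitions_into (S \<union> (P \<inter> {..N})) n = partitions_into (S \<union> P) n"
      by (intro partitions_into_cong) auto
    then show ?case
      by (simp add: multinomial_gf_def multinomial_count_def)
  qed
qed

text \<open>The n-th coefficient of a product involves only the finitely many coefficients of index
  at most n of each factor.\<close>

lemma tendsto_fps_mult:
  fixes f g :: "'b \<Rightarrow> 'a::ring_1 fps"
  assumes "(f \<longlongrightarrow> a) F" and "(g \<longlongrightarrow> b) F"
  shows "((\<lambda>x. f x * g x) \<longlongrightarrow> a * b) F"
proof (rule tendsto_fpsI)
  fix n
  have "\<forall>\<^sub>F x in F. \<forall>i\<in>{..n}. fps_nth (f x) i = fps_nth a i"
    using assms(1) by (intro eventually_ball_finite) (auto simp: tendsto_fps_iff)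
  moreover have "\<forall>\<^sub>F x in F. \<forall>i\<in>{..n}. fps_nth (g x) i = fps_nth b i"
    using assms(2) by (intro eventually_ball_finite) (auto simp: tendsto_fps_iff)
  ultimately show "\<forall>\<^sub>F x in F. fps_nth (f x * g x) n = fps_nth (a * b) n"
    by eventually_elim (auto simp: fps_mult_nth intro!: sum.cong)
qed

theorem theorem11:
  fixes S P :: "nat set"
  assumes "\<forall>s\<in>S. 0 < s"
    and "\<forall>p\<in>P. prime p"
    and "\<forall>s\<in>S. \<forall>p\<in>P. s < p"
  shows "multinomial_gf (S \<union> P) = multinomial_gf S / euler_prod P"
proof -
  have "0 \<notin> P"
    using assms(2) by auto
  note prod = euler_prod_convergent[OF this]
  have "(\<lambda>N. multinomial_gf (S \<union> (P \<inter> {..N})) * (\<Prod>j\<le>N. if j \<in> P then 1 - fps_X ^ j else 1))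
      \<longlonglongrightarrow> multinomial_gf (S \<union> P) * euler_prod P"
    by (intro tendsto_fps_mult multinomial_gf_tendsto has_prod_imp_tendsto[OF prod])
  \<comment> \<open>The sequence is constantly \<open>multinomial_gf S\<close>, so uniqueness of
    limits applies.\<close>
  then have "multinomial_gf (S \<union> P) * euler_prod P = multinomial_gf S"
    using multinomial_gf_Un_primes_atMost[OF assms(2,3)] by (simp add: LIMSEQ_const_iff)
  moreover have "fps_nth (1 - fps_X ^ j :: rat fps) 0 = 1" if "j \<in> P" for j
    using that \<open>0 \<notin> P\<close> by (cases j) auto
  then have factor_nonzero: "(if j \<in> P then 1 - fps_X ^ j else 1 :: rat fps) \<noteq> 0" for j
    by (metis fps_zero_nth zero_neq_one)
  \<comment> \<open>A convergent infinite product vanishes only if some factor does; here each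
    factor has constant term 1.\<close>
  have "euler_prod P \<noteq> 0"
  proof
    assume "euler_prod P = 0"
    then have "0 \<in> range (\<lambda>j. if j \<in> P then 1 - fps_X ^ j else 1 :: rat fps)"
      using has_prod_eq_0_iff[OF prod] by (rule iffD1[rotated])
    then obtain j where "0 = (if j \<in> P then 1 - fps_X ^ j else 1 :: rat fps)"
      by (rule rangeE)
    with factor_nonzero[of j] show False
      by (rule notE[OF _ sym])
  qed
  ultimately show ?thesis
    by (metis nonzero_mult_div_cancel_right)
qed

end
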